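(* Let $\{P_n(x)\}_{n=0}^\infty$ be the sequence of monic orthogonal polynomials with respect to a quasi-definite linear functional $\mathcal{L}$. Let $\mathcal{G}_n^Q(x;a_1)=\mathcal{G}_n(x;a_1)+\beta_n\mathcal{G}_{n-1}(x;a_1)$, with constants $\beta_n$, be a monic quasi-Geronimus polynomial of order one for some $a_1\in\mathbb{R}$. Suppose $\{\mathcal{U}_n(x;a_2)\}_{n=0}^\infty$ is the sequence of monic Uvarov polynomials with respect to the Uvarov transformation $\mathcal{L}^U$ of $\mathcal{L}$ at $a_2\in\mathbb{R}$. Then there exist sequences of constants $\{\zeta_n\}_{n=0}^\infty$, $\{\gamma_n\}_{n=0}^\infty$ and $\{\eta_n\}_{n=0}^\infty$ such that $$P_n(x)=\frac{1}{\zeta_n(x-\eta_n)}\mathcal{G}_{n+1}^Q(x;a_1)+\frac{\gamma_n(x-a_2)}{\zeta_n(x-\eta_n)}\mathcal{U}_n(x;a_2),\qquad n\ge0.$$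
   Context: A linear functional $\mathcal{L}$ on the polynomials with complex coefficients is quasi-definite if there is a sequence of monic polynomials $P_n$, $\deg P_n=n$, with $\mathcal{L}[P_nP_m]=0$ for $n\ne m$ and $\mathcal{L}[P_n^2]\ne0$. The Geronimus transformation of $\mathcal{L}$ at $a_1$ with a constant $M$ is $\mathcal{L}^G[p(x)]=\mathcal{L}\left[\frac{p(x)-p(a_1)}{x-a_1}\right]+Mp(a_1)$; it is assumed quasi-definite, and $\mathcal{G}_n(x;a_1)$ denotes its monic orthogonal polynomial of degree $n$ (Geronimus polynomial). The Uvarov transformation of $\mathcal{L}$ at $a_2$ with a constant $M$ (not necessarily the same one) is $\mathcal{L}^U[p(x)]=\mathcal{L}[p(x)]+Mp(a_2)$; it is assumed quasi-definite, and $\mathcal{U}_n(x;a_2)$ denotes its monic orthogonal polynomial of degree $n$ (Uvarov polynomial).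
   Formalization: Proved for n=0 and those n≥1 where, with h=L[P_n²], u=L^U[U_n²], c=β_{n+1}L^G[G_n²], either u≠h and c≠u, or u=h=c: exactly when the identity can hold with ζ_n≠0. As printed it fails, e.g. if the Uvarov constant M is 0 and β_n=0. *)

theory Defs
  imports "HOL-Computational_Algebra.Polynomial" Complex_Main
begin

definition monic_OPS :: "(complex poly \<Rightarrow> complex) \<Rightarrow> (nat \<Rightarrow> complex poly) \<Rightarrow> bool" where
  "monic_OPS L P \<longleftrightarrow>
     (\<forall>n. degree (P n) = n \<and> lead_coeff (P n) = 1) \<and>
     (\<forall>m n. n \<noteq> m \<longrightarrow> L (P n * P m) = 0) \<and>
     (\<forall>n. L ((P n)\<^sup>2) \<noteq> 0)"

definition quasi_definite :: "(complex poly \<Rightarrow> complex) \<Rightarrow> bool" where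
  "quasi_definite L \<longleftrightarrow> Vector_Spaces.linear smult (*) L \<and> (\<exists>P. monic_OPS L P)"

text \<open>The division below is exact, since \<open>p - p(a)\<close> vanishes at \<open>a\<close>.\<close>

definition geronimus :: "(complex poly \<Rightarrow> complex) \<Rightarrow> complex \<Rightarrow> complex \<Rightarrow> complex poly \<Rightarrow> complex" where
  "geronimus L a M p = L ((p - [:poly p a:]) div [:- a, 1:]) + M * poly p a"

definition uvarov :: "(complex poly \<Rightarrow> complex) \<Rightarrow> complex \<Rightarrow> complex \<Rightarrow> complex poly \<Rightarrow> complex" where
  "uvarov L a M p = L p + M * poly p a"

text \<open>The convention for \<open>n = 0\<close> is \<open>G\<^sub>-\<^sub>1 = 0\<close>.\<close>

definition quasi_geronimus :: "(nat \<Rightarrow> complex poly) \<Rightarrow> (nat \<Rightarrow> complex) \<Rightarrow> nat \<Rightarrow> complex poly" where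
  "quasi_geronimus G \<beta> n = (if n = 0 then G 0 else G n + smult (\<beta> n) (G (n - 1)))"

text \<open>
  Write \<open>h = L[P\<^sub>n\<^sup>2]\<close>, \<open>hG = LG[G\<^sub>n\<^sup>2]\<close>, \<open>hU = LU[U\<^sub>n\<^sup>2]\<close> for the squared norms and \<open>b\<close> for
  \<open>\<beta>\<^sub>n\<^sub>+\<^sub>1\<close>. For \<open>n \<ge> 1\<close>, comparing the components along \<open>P\<^sub>n\<^sub>+\<^sub>1\<close> and \<open>P\<^sub>n\<^sub>-\<^sub>1\<close> in
  \<open>\<zeta> (x - \<eta>) P\<^sub>n = G\<^sub>n\<^sub>+\<^sub>1 + b G\<^sub>n + \<gamma> (x - a2) U\<^sub>n\<close> gives exactly
  \<open>\<zeta> = 1 + \<gamma>\<close> and \<open>\<gamma> (hU - h) = h - b hG\<close>; the component along \<open>P\<^sub>n\<close> fixes \<open>\<eta>\<close>.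
  These equations have a solution with \<open>\<zeta> \<noteq> 0\<close> iff \<open>hU \<noteq> h\<close> and \<open>b hG \<noteq> hU\<close> (the generic case,
  \<open>\<zeta> = (hU - b hG) / (hU - h)\<close>) or \<open>hU = h = b hG\<close>. Here \<open>hU = h\<close> iff the mass of the Uvarov
  transformation is zero or \<open>P\<^sub>n\<close> vanishes at \<open>a2\<close>.
\<close>

definition recovery_nondegenerate ::
  "(complex poly \<Rightarrow> complex) \<Rightarrow> (nat \<Rightarrow> complex poly) \<Rightarrow>
   (complex poly \<Rightarrow> complex) \<Rightarrow> (nat \<Rightarrow> complex poly) \<Rightarrow>
   (complex poly \<Rightarrow> complex) \<Rightarrow> (nat \<Rightarrow> complex poly) \<Rightarrow>
   (nat \<Rightarrow> complex) \<Rightarrow> nat \<Rightarrow> bool" where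
  "recovery_nondegenerate L P LG G LU U \<beta> n \<longleftrightarrow>
     n = 0 \<or>
     (LU ((U n)\<^sup>2) \<noteq> L ((P n)\<^sup>2) \<and> \<beta> (n + 1) * LG ((G n)\<^sup>2) \<noteq> LU ((U n)\<^sup>2)) \<or>
     (LU ((U n)\<^sup>2) = L ((P n)\<^sup>2) \<and> \<beta> (n + 1) * LG ((G n)\<^sup>2) = L ((P n)\<^sup>2))"

end

theory Submission
  imports Defs
begin

text \<open>
  One has \<open>LG[(x - a1) q] = L[q]\<close> and \<open>LU[(x - a2) q] = L[(x - a2) q]\<close>.
  Hence each of the polynomials \<open>(x - \<eta>) P\<^sub>n\<close>, \<open>G\<^sub>n\<^sub>+\<^sub>1 + \<beta> G\<^sub>n\<close> and \<open>(x - a2) U\<^sub>n\<close> is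
  \<open>L\<close>-orthogonal to \<open>P\<^sub>k\<close> for \<open>k + 1 < n\<close>, with known moments against \<open>P\<^sub>n\<^sub>-\<^sub>1\<close>. Choosing
  \<open>\<zeta>, \<gamma>, \<eta>\<close> so that in \<open>\<zeta> (x - \<eta>) P\<^sub>n - G\<^sub>n\<^sub>+\<^sub>1 - \<beta> G\<^sub>n - \<gamma> (x - a2) U\<^sub>n\<close> the coefficient of
  degree \<open>n + 1\<close> and the moments against \<open>P\<^sub>n\<^sub>-\<^sub>1\<close> and \<open>P\<^sub>n\<close> vanish leaves a polynomial of
  degree at most \<open>n\<close> orthogonal to \<open>P\<^sub>0, \<dots>, P\<^sub>n\<close>, which is therefore zero.
\<close>

lemma linear_functionalD:
  fixes L :: "complex poly \<Rightarrow> complex"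
  assumes "Vector_Spaces.linear smult (*) L"
  shows "L (p + q) = L p + L q" "L (p - q) = L p - L q" "L (smult c p) = c * L p" "L 0 = 0"
proof -
  interpret Vector_Spaces.linear smult "(*)" L by fact
  show "L (p + q) = L p + L q" "L (p - q) = L p - L q" "L (smult c p) = c * L p" "L 0 = 0"
    by (simp_all add: add diff scale)
qed

lemma quasi_definite_imp_linear:
  "quasi_definite L \<Longrightarrow> Vector_Spaces.linear smult (*) L"
  by (simp add: quasi_definite_def)

lemma monic_OPS_degree: "monic_OPS L P \<Longrightarrow> degree (P n) = n"
  by (simp add: monic_OPS_def)

lemma monic_OPS_coeff_self: "monic_OPS L P \<Longrightarrow> coeff (P n) n = 1"
  by (metis monic_OPS_def)

lemma monic_OPS_coeff_above: "monic_OPS L P \<Longrightarrow> n < i \<Longrightarrow> coeff (P n) i = 0"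
  by (simp add: coeff_eq_0 monic_OPS_degree)

lemma coeff_linear_factor_mult_OPS:
  assumes "monic_OPS L P" and "k < n"
  shows "coeff ([:- c, 1:] * P k) n = (if n = Suc k then 1 else 0)"
proof -
  obtain m where "n = Suc m" using assms(2) by (cases n) auto
  then show ?thesis
    using assms by (auto simp: monic_OPS_coeff_self monic_OPS_coeff_above)
qed

text \<open>Induction on \<open>m\<close>: subtracting \<open>coeff q m\<close> times
  \<open>P m\<close> lowers the bound by one, and \<open>P m\<close> is itself orthogonal to
  \<open>P n\<close>. Bounding the degree by vanishing coefficients makes the base case
  \<open>q = 0\<close>.\<close>

lemma monic_OPS_orthogonal_lower:
  assumes lin: "Vector_Spaces.linear smult (*) L" and ops: "monic_OPS L P"
    and "\<And>i. m \<le> i \<Longrightarrow> coeff q i = 0" and "m \<le> n"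
  shows "L (q * P n) = 0"
  using assms(3,4)
proof (induction m arbitrary: q)
  case 0
  then have "q = 0" by (simp add: poly_eq_iff)
  then show ?case by (simp add: linear_functionalD[OF lin])
next
  case (Suc m)
  let ?r = "q - smult (coeff q m) (P m)"
  have "coeff ?r i = 0" if "m \<le> i" for i
    using that Suc.prems(1)[of i] monic_OPS_coeff_self[OF ops] monic_OPS_coeff_above[OF ops, of m i]
    by (cases "i = m") auto
  then have "L (?r * P n) = 0" by (rule Suc.IH[OF _ Suc_leD[OF Suc.prems(2)]])
  moreover have "L (P m * P n) = 0" using ops Suc.prems(2) by (simp add: monic_OPS_def)
  ultimately show ?case
    by (simp add: left_diff_distrib linear_functionalD[OF lin])
qed

lemma monic_OPS_moment:
  assumes lin: "Vector_Spaces.linear smult (*) L" and ops: "monic_OPS L P" and deg: "degree q \<le> n"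
  shows "L (q * P n) = coeff q n * L ((P n)\<^sup>2)"
proof -
  let ?r = "q - smult (coeff q n) (P n)"
  have "coeff ?r i = 0" if "n \<le> i" for i
    using that deg monic_OPS_coeff_self[OF ops] monic_OPS_coeff_above[OF ops, of n i]
    by (cases "i = n") (auto simp: coeff_eq_0)
  then have "L (?r * P n) = 0" by (rule monic_OPS_orthogonal_lower[OF lin ops _ order_refl])
  then show ?thesis
    by (simp add: left_diff_distrib linear_functionalD[OF lin] power2_eq_square)
qed

text \<open>The product is monic of degree \<open>k + 1\<close>, at most \<open>n\<close>, so the
  moment reads off its coefficient at \<open>n\<close>. Since \<open>R\<close> may belong to another
  functional, \<open>L\<close> can be a transformed functional while \<open>R\<close> is the
  original sequence.\<close>

lemma monic_OPS_linear_factor_moment: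
  assumes lin: "Vector_Spaces.linear smult (*) L" and ops: "monic_OPS L P"
    and ops': "monic_OPS L' R" and "k < n"
  shows "L ([:- c, 1:] * R k * P n) = (if n = Suc k then L ((P n)\<^sup>2) else 0)"
proof -
  have "degree ([:- c, 1:] * R k) \<le> n"
    using degree_mult_le[of "[:- c, 1:]" "R k"] monic_OPS_degree[OF ops', of k] assms(4) by simp
  then show ?thesis
    by (simp only: monic_OPS_moment[OF lin ops] coeff_linear_factor_mult_OPS[OF ops' assms(4)]) simp
qed

text \<open>The moment against the member of the same degree as \<open>q\<close> is the leading
  coefficient times a nonzero norm.\<close>

lemma monic_OPS_eq_0I:
  assumes lin: "Vector_Spaces.linear smult (*) L" and ops: "monic_OPS L P"
    and deg: "degree q \<le> n" and orth: "\<And>k. k \<le> n \<Longrightarrow> L (q * P k) = 0"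
  shows "q = 0"
proof -
  have "lead_coeff q * L ((P (degree q))\<^sup>2) = 0"
    using monic_OPS_moment[OF lin ops, of q "degree q"] orth[OF deg] by simp
  then show ?thesis using ops by (simp add: monic_OPS_def)
qed

lemma geronimus_linear_factor: "geronimus L a M ([:- a, 1:] * q) = L q"
proof -
  have "([:- a, 1:] * q) div [:- a, 1:] = q"
    by (rule nonzero_mult_div_cancel_left) simp
  moreover have "poly ([:- a, 1:] * q) a = 0" by simp
  ultimately show ?thesis
    by (simp only: geronimus_def) simp
qed

lemma uvarov_linear_factor: "uvarov L a M ([:- a, 1:] * q) = L ([:- a, 1:] * q)"
  by (simp only: uvarov_def poly_mult) simp

text \<open>The factor x - a carries \<open>L\<close> over to the Geronimus functional, where
  \<open>G n\<close> is tested against the monic polynomial (x - a) \<open>P k\<close>.\<close>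

lemma geronimus_polynomial_moment:
  assumes "quasi_definite (geronimus L a M)" and "monic_OPS (geronimus L a M) G"
    and "monic_OPS L P" and "k < n"
  shows "L (G n * P k) = (if n = Suc k then geronimus L a M ((G n)\<^sup>2) else 0)"
  using monic_OPS_linear_factor_moment[OF quasi_definite_imp_linear[OF assms(1)] assms(2-4), of a]
  by (simp only: geronimus_linear_factor mult.assoc mult.commute[of "G n"])

text \<open>The factor x - a kills the point mass, so \<open>L\<close> may be replaced by the Uvarov
  functional, for which \<open>U n\<close> is orthogonal to lower degrees.\<close>

lemma uvarov_polynomial_moment:
  assumes "quasi_definite (uvarov L a M)" and "monic_OPS (uvarov L a M) U"
    and "monic_OPS L P" and "k < n"
  shows "L ([:- a, 1:] * U n * P k) = (if n = Suc k then uvarov L a M ((U n)\<^sup>2) else 0)"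
  using monic_OPS_linear_factor_moment[OF quasi_definite_imp_linear[OF assms(1)] assms(2-4), of a]
  by (simp only: uvarov_linear_factor mult.assoc mult.commute[of "U n"])

lemma recovery_identity:
  assumes qd: "quasi_definite L" and P: "monic_OPS L P"
    and qdG: "quasi_definite (geronimus L a1 M1)" and G: "monic_OPS (geronimus L a1 M1) G"
    and qdU: "quasi_definite (uvarov L a2 M2)" and U: "monic_OPS (uvarov L a2 M2) U"
    and nondeg: "recovery_nondegenerate L P (geronimus L a1 M1) G (uvarov L a2 M2) U \<beta> n"
  shows "\<exists>\<zeta> \<gamma> \<eta>. \<zeta> \<noteq> 0 \<and>
    smult \<zeta> ([:- \<eta>, 1:] * P n) = quasi_geronimus G \<beta> (n + 1) + smult \<gamma> ([:- a2, 1:] * U n)"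
proof -
  note lin = quasi_definite_imp_linear[OF qd]
  note linD = linear_functionalD[OF lin]
  define b where "b = \<beta> (n + 1)"
  define h where "h = L ((P n)\<^sup>2)"
  define hG where "hG = geronimus L a1 M1 ((G n)\<^sup>2)"
  define hU where "hU = uvarov L a2 M2 ((U n)\<^sup>2)"
  define Q where "Q = quasi_geronimus G \<beta> (n + 1)"
  define V where "V = [:- a2, 1:] * U n"
  have Q: "Q = G (Suc n) + smult b (G n)"
    by (simp add: Q_def quasi_geronimus_def b_def)
  have "h \<noteq> 0" using P by (simp add: h_def monic_OPS_def)
  \<comment> \<open>The first equation cancels degree \<open>n + 1\<close>, the last one the moment
    against \<open>P (n - 1)\<close>, which is absent for \<open>n = 0\<close>.\<close>
  obtain \<zeta> \<gamma> where \<zeta>: "\<zeta> = 1 + \<gamma>" "\<zeta> \<noteq> 0" and bal: "n \<noteq> 0 \<Longrightarrow> \<zeta> * h = b * hG + \<gamma> * hU"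
  proof (cases "n \<noteq> 0 \<and> hU \<noteq> h")
    case True
    then have "b * hG \<noteq> hU"
      using nondeg by (auto simp: recovery_nondegenerate_def b_def h_def hG_def hU_def)
    moreover have "1 + (h - b * hG) / (hU - h) = (hU - b * hG) / (hU - h)"
      using True by (simp add: field_simps)
    ultimately show ?thesis
      \<comment> \<open>Here \<gamma> solves the linear equation left after eliminating \<zeta>, and
        \<open>b * hG \<noteq> hU\<close> keeps \<zeta> nonzero.\<close>
      using True by (intro that[of "1 + (h - b * hG) / (hU - h)" "(h - b * hG) / (hU - h)"])
        (simp_all add: field_simps)
  next
    case False
    then have "n \<noteq> 0 \<Longrightarrow> b * hG = h"
      using nondeg by (auto simp: recovery_nondegenerate_def b_def h_def hG_def hU_def)
    \<comment> \<open>The balance is void for \<open>n = 0\<close>; otherwise it reads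
      \<open>h = b * hG\<close> at these values.\<close>
    then show ?thesis by (intro that[of 1 0]) simp_all
  qed
  \<comment> \<open>Solved from the vanishing of the moment of \<open>W\<close> against
    \<open>P n\<close>.\<close>
  define \<eta> where
    "\<eta> = (\<zeta> * L ([:0, 1:] * P n * P n) - L (Q * P n) - \<gamma> * L (V * P n)) / (\<zeta> * h)"
  define W where "W = smult \<zeta> ([:- \<eta>, 1:] * P n) - Q - smult \<gamma> V"
  have LW: "L (W * p) = \<zeta> * L ([:- \<eta>, 1:] * P n * p) - L (Q * p) - \<gamma> * L (V * p)" for p
    by (simp only: W_def left_diff_distrib mult_smult_left linD)
  have "W = 0"
  proof (rule monic_OPS_eq_0I[OF lin P])
    show "degree W \<le> n"
    proof (rule degree_le, intro allI impI)
      fix i assume i: "n < i"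
      then have "coeff Q i = (if i = Suc n then 1 else 0)"
        by (cases "i = Suc n")
          (simp_all add: Q monic_OPS_coeff_self[OF G] monic_OPS_coeff_above[OF G])
      then show "coeff W i = 0"
        by (simp only: W_def V_def coeff_diff coeff_smult coeff_linear_factor_mult_OPS[OF P i]
            coeff_linear_factor_mult_OPS[OF U i]) (simp add: \<zeta>(1))
    qed
  next
    fix k assume "k \<le> n"
    then consider "k < n" | "k = n" by linarith
    then show "L (W * P k) = 0"
    proof cases
      case 1
      have "L ([:- \<eta>, 1:] * P n * P k) = (if n = Suc k then h else 0)"
        using monic_OPS_linear_factor_moment[OF lin P P 1, of \<eta>]
        by (simp only: h_def mult.assoc mult.commute[of "P n"])
      \<comment> \<open>\<open>G (Suc n)\<close> contributes nothing, as \<open>Suc n\<close>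
        differs from \<open>Suc k\<close>; only \<open>b\<close> times \<open>G n\<close>
        can.\<close>
      moreover have "L (Q * P k) = (if n = Suc k then b * hG else 0)"
        using 1 geronimus_polynomial_moment[OF qdG G P, of k]
        by (simp add: Q distrib_right linD hG_def)
      moreover have "L (V * P k) = (if n = Suc k then hU else 0)"
        using uvarov_polynomial_moment[OF qdU U P 1] by (simp only: V_def hU_def)
      ultimately show ?thesis using bal by (auto simp: LW)
    next
      case 2
      have "[:- \<eta>, 1:] * P n * P n = [:0, 1:] * P n * P n - smult \<eta> ((P n)\<^sup>2)"
        by (simp add: power2_eq_square algebra_simps)
      then have "L ([:- \<eta>, 1:] * P n * P n) = L ([:0, 1:] * P n * P n) - \<eta> * h"
        by (simp only: linD h_def)
      moreover have "\<zeta> * (\<eta> * h) = \<zeta> * L ([:0, 1:] * P n * P n) - L (Q * P n) - \<gamma> * L (V * P n)"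
        using \<open>h \<noteq> 0\<close> \<zeta>(2) by (simp add: \<eta>_def)
      ultimately show ?thesis
        by (simp only: LW 2 right_diff_distrib) simp
    qed
  qed
  then have "smult \<zeta> ([:- \<eta>, 1:] * P n) = Q + smult \<gamma> V"
    by (simp add: W_def diff_diff_eq)
  then show ?thesis using \<zeta>(2) unfolding Q_def V_def by blast
qed

theorem theorem3p3:
  fixes L :: "complex poly \<Rightarrow> complex"
    and P G U :: "nat \<Rightarrow> complex poly"
    and \<beta> :: "nat \<Rightarrow> complex"
    and a1 a2 :: real
    and M1 M2 :: complex
  defines "LG \<equiv> geronimus L (complex_of_real a1) M1"
    and "LU \<equiv> uvarov L (complex_of_real a2) M2"
  assumes "quasi_definite L" and "monic_OPS L P"
    and "quasi_definite LG" and "monic_OPS LG G"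
    and "quasi_definite LU" and "monic_OPS LU U"
  shows "\<exists>\<zeta> \<gamma> \<eta> :: nat \<Rightarrow> complex. \<forall>n. recovery_nondegenerate L P LG G LU U \<beta> n \<longrightarrow>
           \<zeta> n \<noteq> 0 \<and>
           (\<forall>x. x \<noteq> \<eta> n \<longrightarrow>
              poly (P n) x =
                1 / (\<zeta> n * (x - \<eta> n)) * poly (quasi_geronimus G \<beta> (n + 1)) x +
                \<gamma> n * (x - complex_of_real a2) / (\<zeta> n * (x - \<eta> n)) * poly (U n) x)"
proof -
  \<comment> \<open>With the implication inside the existential, constants exist for every
    \<open>n\<close>, arbitrary at degenerate ones, and choice yields full sequences.\<close>
  have "\<exists>\<zeta> \<gamma> \<eta>. recovery_nondegenerate L P LG G LU U \<beta> n \<longrightarrow> \<zeta> \<noteq> 0 \<and>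
      smult \<zeta> ([:- \<eta>, 1:] * P n) =
        quasi_geronimus G \<beta> (n + 1) + smult \<gamma> ([:- complex_of_real a2, 1:] * U n)" for n
    using recovery_identity[OF assms(3,4) assms(5-8)[unfolded LG_def LU_def]]
    unfolding LG_def LU_def by blast
  then obtain \<zeta> \<gamma> \<eta> where *: "\<And>n. recovery_nondegenerate L P LG G LU U \<beta> n \<Longrightarrow> \<zeta> n \<noteq> 0 \<and>
      smult (\<zeta> n) ([:- \<eta> n, 1:] * P n) =
        quasi_geronimus G \<beta> (n + 1) + smult (\<gamma> n) ([:- complex_of_real a2, 1:] * U n)"
    by metis
  show ?thesis
  proof (intro exI allI impI conjI)
    fix n assume "recovery_nondegenerate L P LG G LU U \<beta> n"
    note n = *[OF this]
    then show "\<zeta> n \<noteq> 0" by blast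
    fix x assume "x \<noteq> \<eta> n"
    define d where "d = \<zeta> n * (x - \<eta> n)"
    have "d \<noteq> 0" using n \<open>x \<noteq> \<eta> n\<close> by (simp add: d_def)
    have "poly (smult (\<zeta> n) ([:- \<eta> n, 1:] * P n)) x = d * poly (P n) x"
      by (simp add: d_def algebra_simps)
    moreover have "poly (smult (\<gamma> n) ([:- complex_of_real a2, 1:] * U n)) x =
        \<gamma> n * (x - complex_of_real a2) * poly (U n) x"
      by (simp add: algebra_simps)
    ultimately have "d * poly (P n) x = poly (quasi_geronimus G \<beta> (n + 1)) x +
        \<gamma> n * (x - complex_of_real a2) * poly (U n) x"
      using n by (metis poly_add)
    then have "poly (P n) x = 1 / d * poly (quasi_geronimus G \<beta> (n + 1)) x +
        \<gamma> n * (x - complex_of_real a2) / d * poly (U n) x"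
      using \<open>d \<noteq> 0\<close> by (simp add: field_simps)
    then show "poly (P n) x =
        1 / (\<zeta> n * (x - \<eta> n)) * poly (quasi_geronimus G \<beta> (n + 1)) x +
        \<gamma> n * (x - complex_of_real a2) / (\<zeta> n * (x - \<eta> n)) * poly (U n) x"
      unfolding d_def .
  qed
qed

end
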